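(* Let $L=\mathrm{Log}(\mathcal F_L)$ be a tabular quasi-normal modal logic with the Craig interpolation property, where $\mathcal F_L$ is a finite set of finite frames each rooted at $0$. Let $\varphi\to\psi\in L$ and $\sigma=\mathrm{sig}(\varphi)\cap\mathrm{sig}(\psi)$. If for each $\mathfrak F\in\mathcal F_L$, $\xi_{\mathfrak F}\in\mathrm{PL}(\sigma_{\mathfrak F})$ is a propositional Craig interpolant for $\mathit{tr}_{\mathfrak F,0}(\varphi)\to\mathit{tr}_{\mathfrak F,0}(\psi)$, then $\bigvee_{\mathfrak F\in\mathcal F_L}\mathit{rt}_{\mathfrak F,L}(\xi_{\mathfrak F})$ is a Craig interpolant for $\varphi\to\psi$ in $L$.
   Context: For $\mathfrak F=(W,R)$: $\sigma'_{\mathfrak F}=\{p_w:p\in\sigma',w\in W\}$; $\mathit{tr}_{\mathfrak F,w}$: $p\mapsto p_w$, commutes with $\top,\neg,\wedge$, $\Diamond\chi\mapsto\bigvee_{(w,w')\in R}\mathit{tr}_{\mathfrak F,w'}(\chi)$ ($\Box=\neg\Diamond\neg$). $N=\max_{\mathfrak G\in\mathcal F_L}|\mathfrak G|$; $\Box^{\le N}\chi=\chi\wedge\Box\chi\wedge\dots\wedge\Box^N\chi$, $\Diamond^{\le N}=\neg\Box^{\le N}\neg$. $\sigma$-EME: finite pairwise inconsistent set $\Phi$ of propositional formulas over $\sigma$ with tautological disjunction; $\sigma$-cover of a model: worlds satisfying the same member agree on $\sigma$. $\mathit{cover}(\sigma,\Phi)=\bigwedge_{\phi\in\Phi}\bigwedge_{p\in\sigma}(\Diamond^{\le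 N}(\phi\wedge p)\to\Box^{\le N}(\phi\to p))$. Abstract $\Phi$-model for $L$: $(\mathfrak G,f)$, $\mathfrak G\in\mathcal F_L$, $f$ from worlds to $\Phi$; formulas over $\Phi$ treat its members as atoms ($w\models\phi$ iff $f(w)=\phi$); abstract $\Phi$-bisimulations satisfy Forth, Back and equal $f$-values on related worlds. An abstract class identifier is a formula $\delta$ over $\Phi$ such that the abstract $\Phi$-models for $L$ satisfying $\delta$ at the root form exactly one class of abstract-$\Phi$-bisimilarity at roots, denoted $[\delta]_L$. A $\sigma$-encoding for $L$: $(\Gamma,\{\Delta_\Phi\}_{\Phi\in\Gamma})$ such that each model on a frame in $\mathcal F_L$ has a $\sigma$-cover $\Phi\in\Gamma$ and some $\delta\in\Delta_\Phi$ true at its root. With a fixed $\sigma$-encoding, $\mathit{rt}_{\mathfrak F,L}(\xi)=\bigwedge_{\Phi\in\Gamma}\bigwedge_{\delta\in\Delta_\Phi}((\mathit{cover}(\sigma,\Phi)\wedge\delta)\to\bigvee_{(\mathfrak F,f)\in[\delta]_L}\xi^f)$ (disjunction over members of $[\delta]_L$ based on $\mathfrak F$), $\xi^f$ obtained by replacing $p_w$ by $\Diamond^{\le N}(f(w)\wedge p)$. Craig interpolant for $\varphi\to\psi\in L$: modal $\chi$ with $\varphi\to\chi,\chi\to\psi\in L$ and $\mathrm{sig}(\chi)\subseteq\mathrm{sig}(\varphi)\cap\mathrm{sig}(\psi)$; $L$ has the Craig interpolation property if all $\varphi\to\psi\in L$ have one. Propositional Craig interpolant for a tautology $\alpha\to\beta$: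 propositional $\chi$ with $\alpha\to\chi$, $\chi\to\beta$ tautologies and $\mathrm{sig}(\chi)\subseteq\mathrm{sig}(\alpha)\cap\mathrm{sig}(\beta)$. $\mathrm{Log}(\mathcal F_L)$: formulas true at the root of every model on every frame of $\mathcal F_L$.
   Formalization: The formal theorem additionally assumes that no proper subset of F_L already determines L; without this the claim is false, e.g. for F_L = {reflexive point, two-element cluster}, φ = ¬⊤, ψ = ◇q→□q. *)

theory Defs
  imports Main "HOL-Library.FuncSet" "HOL-Library.Infinite_Typeclass"
begin

section \<open>Propositional and modal formulas\<close>

datatype (psig: 'p) pl =
    PTop
  | PVar 'p
  | PNeg "'p pl"
  | PAnd "'p pl" "'p pl"

datatype (sig: 'p) fm =
    Top
  | Var 'p
  | Neg "'p fm"
  | And "'p fm" "'p fm"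
  | Dia "'p fm"

abbreviation POr :: "'p pl \<Rightarrow> 'p pl \<Rightarrow> 'p pl" where
  "POr \<alpha> \<beta> \<equiv> PNeg (PAnd (PNeg \<alpha>) (PNeg \<beta>))"

abbreviation PImp :: "'p pl \<Rightarrow> 'p pl \<Rightarrow> 'p pl" where
  "PImp \<alpha> \<beta> \<equiv> PNeg (PAnd \<alpha> (PNeg \<beta>))"

abbreviation Or :: "'p fm \<Rightarrow> 'p fm \<Rightarrow> 'p fm" where
  "Or \<phi> \<psi> \<equiv> Neg (And (Neg \<phi>) (Neg \<psi>))"

abbreviation Imp :: "'p fm \<Rightarrow> 'p fm \<Rightarrow> 'p fm" where
  "Imp \<phi> \<psi> \<equiv> Neg (And \<phi> (Neg \<psi>))"

abbreviation Box :: "'p fm \<Rightarrow> 'p fm" where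
  "Box \<phi> \<equiv> Neg (Dia (Neg \<phi>))"

text \<open>
  Conjunctions and disjunctions over a finite set are taken along an arbitrary fixed enumeration
  of that set without repetitions; the empty ones are \<open>\<top>\<close> and \<open>\<not>\<top>\<close>. All sets to which these
  operators are applied below are finite.
\<close>

definition enum_of :: "'a set \<Rightarrow> 'a list" where
  "enum_of A = (SOME xs. set xs = A \<and> distinct xs)"

definition PBigOr :: "'p pl set \<Rightarrow> 'p pl" where
  "PBigOr A = foldr POr (enum_of A) (PNeg PTop)"

definition BigAnd :: "'p fm set \<Rightarrow> 'p fm" where
  "BigAnd A = foldr And (enum_of A) Top"

definition BigOr :: "'p fm set \<Rightarrow> 'p fm" where
  "BigOr A = foldr Or (enum_of A) (Neg Top)"

primrec psubst :: "('p \<Rightarrow> 'q fm) \<Rightarrow> 'p pl \<Rightarrow> 'q fm" where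
  "psubst s PTop = Top"
| "psubst s (PVar p) = s p"
| "psubst s (PNeg \<alpha>) = Neg (psubst s \<alpha>)"
| "psubst s (PAnd \<alpha> \<beta>) = And (psubst s \<alpha>) (psubst s \<beta>)"

primrec subst :: "('p \<Rightarrow> 'q fm) \<Rightarrow> 'p fm \<Rightarrow> 'q fm" where
  "subst s Top = Top"
| "subst s (Var p) = s p"
| "subst s (Neg \<phi>) = Neg (subst s \<phi>)"
| "subst s (And \<phi> \<psi>) = And (subst s \<phi>) (subst s \<psi>)"
| "subst s (Dia \<phi>) = Dia (subst s \<phi>)"

abbreviation emb :: "'p pl \<Rightarrow> 'p fm" where
  "emb \<equiv> psubst Var"

primrec peval :: "('p \<Rightarrow> bool) \<Rightarrow> 'p pl \<Rightarrow> bool" where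
  "peval v PTop = True"
| "peval v (PVar p) = v p"
| "peval v (PNeg \<alpha>) = (\<not> peval v \<alpha>)"
| "peval v (PAnd \<alpha> \<beta>) = (peval v \<alpha> \<and> peval v \<beta>)"

definition taut :: "'p pl \<Rightarrow> bool" where
  "taut \<alpha> \<longleftrightarrow> (\<forall>v. peval v \<alpha>)"


section \<open>Frames, models and logics\<close>

type_synonym 'w frame = "'w set \<times> ('w \<times> 'w) set"

abbreviation worlds :: "'w frame \<Rightarrow> 'w set" where "worlds \<equiv> fst"
abbreviation acc :: "'w frame \<Rightarrow> ('w \<times> 'w) set" where "acc \<equiv> snd"

text \<open>
  The type class \<open>zero\<close> only supplies the name \<open>0\<close> of the root; nothing else is assumed about
  the type of worlds.
\<close>

definition rooted_frame :: "'w::zero frame \<Rightarrow> bool" where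
  "rooted_frame F \<longleftrightarrow>
     acc F \<subseteq> worlds F \<times> worlds F \<and> 0 \<in> worlds F \<and> (\<forall>w\<in>worlds F. (0, w) \<in> (acc F)\<^sup>*)"

text \<open>
  A model is a frame \<open>F\<close> with a valuation \<open>V\<close>, where \<open>V w p\<close> says that \<open>p\<close> is true at \<open>w\<close>; the
  values of \<open>V\<close> outside \<open>worlds F\<close> are irrelevant.
\<close>

primrec sat :: "'w frame \<Rightarrow> ('w \<Rightarrow> 'p \<Rightarrow> bool) \<Rightarrow> 'w \<Rightarrow> 'p fm \<Rightarrow> bool" where
  "sat F V w Top = True"
| "sat F V w (Var p) = V w p"
| "sat F V w (Neg \<phi>) = (\<not> sat F V w \<phi>)"
| "sat F V w (And \<phi> \<psi>) = (sat F V w \<phi> \<and> sat F V w \<psi>)"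
| "sat F V w (Dia \<phi>) = (\<exists>w'. (w, w') \<in> acc F \<and> sat F V w' \<phi>)"

definition Log :: "'w::zero frame set \<Rightarrow> 'p fm set" where
  "Log FL = {\<phi>. \<forall>F\<in>FL. \<forall>V. sat F V 0 \<phi>}"

text \<open>
  A tabular logic \<open>L = Log FL\<close> will be presented by a set \<open>FL\<close> without superfluous frames, that is,
  \<open>Log FL' \<noteq> L\<close> for all \<open>FL' \<subset> FL\<close>. Every tabular logic has such a presentation (discard
  superfluous frames one by one), and the theorem is false without this condition: let \<open>FL\<close> consist of the
  reflexive point and the two-element cluster, \<open>\<phi> = \<not>\<top>\<close>, \<open>\<psi> = \<diamond>q \<rightarrow> \<box>q\<close>, so that
  \<open>\<sigma> = {}\<close>, and take \<open>\<Gamma> = {{\<top>}}\<close> and \<open>\<Delta>\<close> constantly \<open>{\<top>}\<close>. Then \<open>\<top>\<close> and \<open>\<not>\<top>\<close> are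
  propositional interpolants for the point and for the cluster, but the disjunction built from them
  is equivalent to \<open>\<top>\<close>, which does not imply \<open>\<psi>\<close> on the cluster.
\<close>

inductive_set K_logic :: "'p fm set" where
  taut: "taut (\<alpha> :: 'p pl) \<Longrightarrow> psubst s \<alpha> \<in> K_logic"
| dist: "Imp (Box (Imp \<phi> \<psi>)) (Imp (Box \<phi>) (Box \<psi>)) \<in> K_logic"
| mp: "Imp \<phi> \<psi> \<in> K_logic \<Longrightarrow> \<phi> \<in> K_logic \<Longrightarrow> \<psi> \<in> K_logic"
| nec: "\<phi> \<in> K_logic \<Longrightarrow> Box \<phi> \<in> K_logic"

definition quasi_normal :: "'p fm set \<Rightarrow> bool" where
  "quasi_normal L \<longleftrightarrow>
     K_logic \<subseteq> L \<and>
     (\<forall>\<phi> \<psi>. Imp \<phi> \<psi> \<in> L \<longrightarrow> \<phi> \<in> L \<longrightarrow> \<psi> \<in> L) \<and>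
     (\<forall>s. \<forall>\<phi>\<in>L. subst s \<phi> \<in> L)"

lemma sat_psubst: "sat F V w (psubst s \<alpha>) \<longleftrightarrow> peval (\<lambda>p. sat F V w (s p)) \<alpha>"
  by (induction \<alpha>) auto

lemma sat_subst: "sat F V w (subst s \<phi>) \<longleftrightarrow> sat F (\<lambda>u p. sat F V u (s p)) w \<phi>"
  by (induction \<phi> arbitrary: w) auto

lemma K_logic_sound: "\<phi> \<in> K_logic \<Longrightarrow> sat F V w \<phi>"
proof (induction arbitrary: w rule: K_logic.induct)
  case (taut \<alpha> s)
  then show ?case by (simp add: sat_psubst taut_def)
qed auto

text \<open>Every logic of the form \<open>Log FL\<close> is quasi-normal.\<close>

lemma quasi_normal_Log: "quasi_normal (Log FL)"
  unfolding quasi_normal_def Log_def by (auto simp: K_logic_sound sat_subst)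


section \<open>Craig interpolants\<close>

definition craig_interpolant :: "'p fm set \<Rightarrow> 'p fm \<Rightarrow> 'p fm \<Rightarrow> 'p fm \<Rightarrow> bool" where
  "craig_interpolant L \<phi> \<psi> \<chi> \<longleftrightarrow>
     Imp \<phi> \<chi> \<in> L \<and> Imp \<chi> \<psi> \<in> L \<and> sig \<chi> \<subseteq> sig \<phi> \<inter> sig \<psi>"

definition craig_property :: "'p fm set \<Rightarrow> bool" where
  "craig_property L \<longleftrightarrow> (\<forall>\<phi> \<psi>. Imp \<phi> \<psi> \<in> L \<longrightarrow> (\<exists>\<chi>. craig_interpolant L \<phi> \<psi> \<chi>))"

definition prop_craig_interpolant :: "'p pl \<Rightarrow> 'p pl \<Rightarrow> 'p pl \<Rightarrow> bool" where
  "prop_craig_interpolant \<alpha> \<beta> \<chi> \<longleftrightarrow>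
     taut (PImp \<alpha> \<chi>) \<and> taut (PImp \<chi> \<beta>) \<and> psig \<chi> \<subseteq> psig \<alpha> \<inter> psig \<beta>"


section \<open>Translation of modal into propositional formulas over a frame\<close>

text \<open>The propositional variable \<open>p\<^sub>w\<close> is the pair \<open>(p, w)\<close>.\<close>

primrec tr :: "'w frame \<Rightarrow> 'w \<Rightarrow> 'p fm \<Rightarrow> ('p \<times> 'w) pl" where
  "tr F w Top = PTop"
| "tr F w (Var p) = PVar (p, w)"
| "tr F w (Neg \<phi>) = PNeg (tr F w \<phi>)"
| "tr F w (And \<phi> \<psi>) = PAnd (tr F w \<phi>) (tr F w \<psi>)"
| "tr F w (Dia \<phi>) = PBigOr ((\<lambda>w'. tr F w' \<phi>) ` {w'. (w, w') \<in> acc F})"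


section \<open>Covers\<close>

definition max_size :: "'w frame set \<Rightarrow> nat" where
  "max_size FL = Max ((\<lambda>F. card (worlds F)) ` FL)"

definition box_le :: "nat \<Rightarrow> 'p fm \<Rightarrow> 'p fm" where
  "box_le n \<phi> = foldr And (map (\<lambda>i. ((\<lambda>\<psi>. Box \<psi>) ^^ i) \<phi>) [0..<Suc n]) Top"

definition dia_le :: "nat \<Rightarrow> 'p fm \<Rightarrow> 'p fm" where
  "dia_le n \<phi> = Neg (box_le n (Neg \<phi>))"

definition EME :: "'p set \<Rightarrow> 'p pl set \<Rightarrow> bool" where
  "EME \<sigma> \<Phi> \<longleftrightarrow>
     finite \<Phi> \<and> (\<forall>\<phi>\<in>\<Phi>. psig \<phi> \<subseteq> \<sigma>) \<and>
     (\<forall>\<phi>\<in>\<Phi>. \<forall>\<phi>'\<in>\<Phi>. \<phi> \<noteq> \<phi>' \<longrightarrow> taut (PNeg (PAnd \<phi> \<phi>'))) \<and>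
     taut (PBigOr \<Phi>)"

definition is_cover :: "'p set \<Rightarrow> 'p pl set \<Rightarrow> 'w frame \<Rightarrow> ('w \<Rightarrow> 'p \<Rightarrow> bool) \<Rightarrow> bool" where
  "is_cover \<sigma> \<Phi> F V \<longleftrightarrow>
     EME \<sigma> \<Phi> \<and>
     (\<forall>\<phi>\<in>\<Phi>. \<forall>w\<in>worlds F. \<forall>w'\<in>worlds F.
        sat F V w (emb \<phi>) \<and> sat F V w' (emb \<phi>) \<longrightarrow> (\<forall>p\<in>\<sigma>. V w p \<longleftrightarrow> V w' p))"

definition cover :: "nat \<Rightarrow> 'p set \<Rightarrow> 'p pl set \<Rightarrow> 'p fm" where
  "cover N \<sigma> \<Phi> =
     BigAnd ((\<lambda>(\<phi>, p). Imp (dia_le N (And (emb \<phi>) (Var p))) (box_le N (Imp (emb \<phi>) (Var p))))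
             ` (\<Phi> \<times> \<sigma>))"


section \<open>Abstract models and encodings\<close>

text \<open>
  Formulas over \<open>\<Phi>\<close> are modal formulas whose atoms are the members of \<open>\<Phi>\<close>, so they have type
  \<^typ>\<open>'p pl fm\<close>; \<open>unabs\<close> reads them as modal formulas over the original variables.
\<close>

definition unabs :: "'p pl fm \<Rightarrow> 'p fm" where
  "unabs \<delta> = subst emb \<delta>"

type_synonym ('w, 'p) abs_model = "'w frame \<times> ('w \<Rightarrow> 'p pl)"

text \<open>
  The function of an abstract model is extensional, so that it is determined by its values on the
  worlds and a finite frame carries only finitely many abstract \<open>\<Phi>\<close>-models.
\<close>

definition abs_models :: "'w frame set \<Rightarrow> 'p pl set \<Rightarrow> ('w, 'p) abs_model set" where
  "abs_models FL \<Phi> = {(G, f). G \<in> FL \<and> f \<in> worlds G \<rightarrow>\<^sub>E \<Phi>}"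

definition abs_sat :: "('w::zero, 'p) abs_model \<Rightarrow> 'p pl fm \<Rightarrow> bool" where
  "abs_sat M \<delta> \<longleftrightarrow> sat (fst M) (\<lambda>w \<phi>. snd M w = \<phi>) 0 \<delta>"

definition abs_bisim :: "('w, 'p) abs_model \<Rightarrow> ('w, 'p) abs_model \<Rightarrow> ('w \<times> 'w) set \<Rightarrow> bool" where
  "abs_bisim M M' Z \<longleftrightarrow>
     Z \<subseteq> worlds (fst M) \<times> worlds (fst M') \<and>
     (\<forall>(w, w')\<in>Z.
        snd M w = snd M' w' \<and>
        (\<forall>v. (w, v) \<in> acc (fst M) \<longrightarrow> (\<exists>v'. (w', v') \<in> acc (fst M') \<and> (v, v') \<in> Z)) \<and>
        (\<forall>v'. (w', v') \<in> acc (fst M') \<longrightarrow> (\<exists>v. (w, v) \<in> acc (fst M) \<and> (v, v') \<in> Z)))"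

definition abs_bisimilar :: "('w::zero, 'p) abs_model \<Rightarrow> ('w, 'p) abs_model \<Rightarrow> bool" where
  "abs_bisimilar M M' \<longleftrightarrow> (\<exists>Z. abs_bisim M M' Z \<and> (0, 0) \<in> Z)"

text \<open>\<open>abs_class FL \<Phi> \<delta>\<close> is \<open>[\<delta>]\<^sub>L\<close>.\<close>

definition abs_class ::
    "'w::zero frame set \<Rightarrow> 'p pl set \<Rightarrow> 'p pl fm \<Rightarrow> ('w, 'p) abs_model set" where
  "abs_class FL \<Phi> \<delta> = {M \<in> abs_models FL \<Phi>. abs_sat M \<delta>}"

definition class_identifier :: "'w::zero frame set \<Rightarrow> 'p pl set \<Rightarrow> 'p pl fm \<Rightarrow> bool" where
  "class_identifier FL \<Phi> \<delta> \<longleftrightarrow>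
     sig \<delta> \<subseteq> \<Phi> \<and>
     (\<exists>M\<in>abs_models FL \<Phi>. abs_class FL \<Phi> \<delta> = {M' \<in> abs_models FL \<Phi>. abs_bisimilar M M'})"

definition encoding ::
    "'w::zero frame set \<Rightarrow> 'p set \<Rightarrow> 'p pl set set \<Rightarrow> ('p pl set \<Rightarrow> 'p pl fm set) \<Rightarrow> bool" where
  "encoding FL \<sigma> \<Gamma> \<Delta> \<longleftrightarrow>
     finite \<Gamma> \<and>
     (\<forall>\<Phi>\<in>\<Gamma>. EME \<sigma> \<Phi> \<and> finite (\<Delta> \<Phi>) \<and> (\<forall>\<delta>\<in>\<Delta> \<Phi>. class_identifier FL \<Phi> \<delta>)) \<and>
     (\<forall>F\<in>FL. \<forall>V. \<exists>\<Phi>\<in>\<Gamma>. is_cover \<sigma> \<Phi> F V \<and> (\<exists>\<delta>\<in>\<Delta> \<Phi>. sat F V 0 (unabs \<delta>)))"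

text \<open>\<open>abs_inst N f \<xi>\<close> is \<open>\<xi>\<^sup>f\<close>.\<close>

definition abs_inst :: "nat \<Rightarrow> ('w \<Rightarrow> 'p pl) \<Rightarrow> ('p \<times> 'w) pl \<Rightarrow> 'p fm" where
  "abs_inst N f \<xi> = psubst (\<lambda>(p, w). dia_le N (And (emb (f w)) (Var p))) \<xi>"

definition rt ::
    "'w::zero frame set \<Rightarrow> 'p set \<Rightarrow> 'p pl set set \<Rightarrow> ('p pl set \<Rightarrow> 'p pl fm set) \<Rightarrow>
     'w frame \<Rightarrow> ('p \<times> 'w) pl \<Rightarrow> 'p fm" where
  "rt FL \<sigma> \<Gamma> \<Delta> F \<xi> =
     BigAnd (\<Union>\<Phi>\<in>\<Gamma>. (\<lambda>\<delta>. Imp (And (cover (max_size FL) \<sigma> \<Phi>) (unabs \<delta>))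
                              (BigOr {abs_inst (max_size FL) f \<xi> | f. (F, f) \<in> abs_class FL \<Phi> \<delta>}))
                     ` \<Delta> \<Phi>)"

end

theory Submission
  imports Defs
begin

text \<open>
  Write \<open>N\<close> for the maximal frame size. In a model on a frame \<open>F\<close> with a \<open>\<sigma>\<close>-cover \<open>\<Phi>\<close>, labelling
  each world with the member of \<open>\<Phi>\<close> true there gives an abstract model \<open>(F, g)\<close> such that \<open>p\<close> holds
  at \<open>w\<close> iff \<open>\<diamond>\<^sup>\<le>\<^sup>N(g(w) \<and> p)\<close> holds at the root. Hence \<open>\<xi>\<^sup>g\<close> has the value of \<open>\<xi>\<close> in the model, which
  makes \<open>\<phi>\<close> imply the disjunction.

  Conversely, let \<open>(F, V)\<close> refute \<open>\<psi>\<close> and satisfy the disjunct of a frame \<open>G\<close>. Then \<open>\<xi>\<^sub>G\<close> holds in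
  a model \<open>(G, U)\<close> having the same \<open>\<sigma>\<close>-theory as \<open>(F, V)\<close>. Describe \<open>(G, U)\<close>, with its worlds named by
  fresh variables, by a formula \<open>\<beta>\<close>. If \<open>\<not>\<psi> \<rightarrow> \<not>\<beta>\<close> were in \<open>L\<close>, its Craig interpolant would separate
  the two \<open>\<sigma>\<close>-theories. So \<open>\<not>\<psi> \<and> \<beta>\<close> is satisfied on some frame \<open>H\<close>, and reading off the names
  gives a surjective p-morphism from \<open>H\<close> to \<open>G\<close>. As \<open>G\<close> is not superfluous, \<open>H = G\<close>; the
  p-morphism is then an automorphism, and transporting the model along it refutes \<open>\<psi>\<close> in a model on
  \<open>G\<close> agreeing with \<open>U\<close> on \<open>\<sigma>\<close>. This contradicts that \<open>\<xi>\<^sub>G\<close> implies the translation of \<open>\<psi>\<close>.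
\<close>

section \<open>Semantics of the derived connectives\<close>

lemma set_enum_of [simp]: "finite A \<Longrightarrow> set (enum_of A) = A"
  unfolding enum_of_def by (rule someI2_ex[OF finite_distinct_list]) auto

lemma peval_PBigOr: "finite A \<Longrightarrow> peval v (PBigOr A) \<longleftrightarrow> (\<exists>\<alpha>\<in>A. peval v \<alpha>)"
proof -
  have "peval v (foldr POr xs (PNeg PTop)) \<longleftrightarrow> (\<exists>\<alpha>\<in>set xs. peval v \<alpha>)" for xs
    by (induction xs) auto
  then show "finite A \<Longrightarrow> ?thesis" by (simp add: PBigOr_def)
qed

lemma sat_BigAnd: "finite A \<Longrightarrow> sat F V w (BigAnd A) \<longleftrightarrow> (\<forall>\<phi>\<in>A. sat F V w \<phi>)"
proof -
  have "sat F V w (foldr And xs Top) \<longleftrightarrow> (\<forall>\<phi>\<in>set xs. sat F V w \<phi>)" for xs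
    by (induction xs) auto
  then show "finite A \<Longrightarrow> ?thesis" by (simp add: BigAnd_def)
qed

lemma sat_BigOr: "finite A \<Longrightarrow> sat F V w (BigOr A) \<longleftrightarrow> (\<exists>\<phi>\<in>A. sat F V w \<phi>)"
proof -
  have "sat F V w (foldr Or xs (Neg Top)) \<longleftrightarrow> (\<exists>\<phi>\<in>set xs. sat F V w \<phi>)" for xs
    by (induction xs) auto
  then show "finite A \<Longrightarrow> ?thesis" by (simp add: BigOr_def)
qed

lemma sig_BigAnd: "finite A \<Longrightarrow> sig (BigAnd A) = (\<Union>\<phi>\<in>A. sig \<phi>)"
proof -
  have "sig (foldr And xs Top) = (\<Union>\<phi>\<in>set xs. sig \<phi>)" for xs :: "'a fm list"
    by (induction xs) auto
  then show "finite A \<Longrightarrow> ?thesis" by (simp add: BigAnd_def)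
qed

lemma sig_BigOr: "finite A \<Longrightarrow> sig (BigOr A) = (\<Union>\<phi>\<in>A. sig \<phi>)"
proof -
  have "sig (foldr Or xs (Neg Top)) = (\<Union>\<phi>\<in>set xs. sig \<phi>)" for xs :: "'a fm list"
    by (induction xs) auto
  then show "finite A \<Longrightarrow> ?thesis" by (simp add: BigOr_def)
qed

lemma finite_sig: "finite (sig \<phi>)"
  by (induction \<phi>) auto

lemma sig_psubst: "sig (psubst s \<alpha>) = (\<Union>p\<in>psig \<alpha>. sig (s p))"
  by (induction \<alpha>) auto

lemma sig_subst: "sig (subst s \<phi>) = (\<Union>p\<in>sig \<phi>. sig (s p))"
  by (induction \<phi>) auto

lemma peval_cong: "(\<And>p. p \<in> psig \<alpha> \<Longrightarrow> v p \<longleftrightarrow> v' p) \<Longrightarrow> peval v \<alpha> \<longleftrightarrow> peval v' \<alpha>"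
  by (induction \<alpha>) auto

section \<open>Bounded modalities at the root of a finite frame\<close>

lemma sat_Box_power:
  "sat F V w (((\<lambda>\<psi>. Box \<psi>) ^^ i) \<phi>) \<longleftrightarrow> (\<forall>v. (w, v) \<in> acc F ^^ i \<longrightarrow> sat F V v \<phi>)"
proof (induction i arbitrary: w)
  case (Suc i)
  then show ?case
    \<comment> \<open>The outermost \<open>Box\<close> is the first step of a path, so the power is
      split on the left; \<open>relpow.simps(2)\<close> would split off the last step.\<close>
    by (auto dest: relpow_Suc_D2 intro: relpow_Suc_I2 simp del: relpow.simps(2))
qed auto

lemma sat_box_le:
  "sat F V w (box_le n \<phi>) \<longleftrightarrow> (\<forall>i\<le>n. \<forall>v. (w, v) \<in> acc F ^^ i \<longrightarrow> sat F V v \<phi>)"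
proof -
  have "sat F V w (foldr And xs Top) \<longleftrightarrow> (\<forall>\<phi>\<in>set xs. sat F V w \<phi>)" for xs
    by (induction xs) auto
  then show ?thesis
    unfolding box_le_def by (auto simp: sat_Box_power less_Suc_eq_le simp del: upt_Suc)
qed

lemma sig_box_le: "sig (box_le n \<phi>) = sig \<phi>"
proof -
  have pow: "sig (((\<lambda>\<psi>. Box \<psi>) ^^ i) \<phi>) = sig \<phi>" for i
    by (induction i) auto
  have "sig (foldr And xs Top) = (\<Union>\<phi>\<in>set xs. sig \<phi>)" for xs :: "'a fm list"
    by (induction xs) auto
  then show ?thesis
    unfolding box_le_def by (simp add: pow del: upt_Suc)
qed

lemma sig_dia_le: "sig (dia_le n \<phi>) = sig \<phi>"
  by (simp add: dia_le_def sig_box_le)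

text \<open>A shortest path repeats no vertex, so its \<open>n + 1\<close> vertices are distinct
  elements of \<open>W\<close>.\<close>

lemma relpow_less_card:
  assumes "finite W" "R \<subseteq> W \<times> W" "x \<in> W" "(x, y) \<in> R\<^sup>*"
  obtains n where "n < card W" "(x, y) \<in> R ^^ n"
proof -
  define n where "n = (LEAST n. (x, y) \<in> R ^^ n)"
  obtain m where m: "(x, y) \<in> R ^^ m"
    using assms(4) by (auto simp: rtrancl_power)
  then have n: "(x, y) \<in> R ^^ n"
    unfolding n_def by (rule LeastI)
  then obtain f where f: "f 0 = x" "f n = y" "\<And>i. i < n \<Longrightarrow> (f i, f (Suc i)) \<in> R"
    by (auto simp: relpow_fun_conv)
  have seg: "(f i, f (i + k)) \<in> R ^^ k" if "i + k \<le> n" for i k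
    using that f(3) by (auto simp: relpow_fun_conv intro!: exI[of _ "\<lambda>j. f (i + j)"])
  have "f i \<noteq> f j" if "i < j" "j \<le> n" for i j
  proof
    assume eq: "f i = f j"
    \<comment> \<open>The loop between \<open>i\<close> and \<open>j\<close> is cut out, which would
      give a shorter path.\<close>
    have "(x, f i) \<in> R ^^ i" "(f j, y) \<in> R ^^ (n - j)"
      using seg[of 0 i] seg[of j "n - j"] that f by auto
    then have "(x, y) \<in> R ^^ (i + (n - j))"
      unfolding relpow_add eq by blast
    then have "n \<le> i + (n - j)"
      unfolding n_def by (rule Least_le)
    then show False using that by simp
  qed
  then have inj: "inj_on f {..n}"
    by (metis atMost_iff inj_onI linorder_neqE_nat)
  have "f i \<in> W" if "i \<le> n" for i
  proof (cases i)
    case 0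
    then show ?thesis using f(1) assms(3) by simp
  next
    case (Suc j)
    then show ?thesis using f(3)[of j] that assms(2) by auto
  qed
  then have "card {..n} \<le> card W"
    by (intro card_inj_on_le[OF inj] assms(1)) auto
  then show thesis
    by (intro that[OF _ n]) simp
qed

lemma rooted_frame_acc: "rooted_frame F \<Longrightarrow> acc F \<subseteq> worlds F \<times> worlds F"
  and rooted_frame_root: "rooted_frame F \<Longrightarrow> 0 \<in> worlds F"
  by (simp_all add: rooted_frame_def)

lemma relpow_worlds:
  assumes "acc F \<subseteq> worlds F \<times> worlds F" "w \<in> worlds F" "(w, v) \<in> acc F ^^ n"
  shows "v \<in> worlds F"
  using assms by (cases n) auto

text \<open>Every world is reached from the root in fewer than \<open>card (worlds F)\<close> steps,
  so at the root the bounded box acts as a universal modality.\<close>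

lemma sat_box_le_root:
  assumes "finite (worlds F)" "rooted_frame F" "card (worlds F) \<le> n"
  shows "sat F V 0 (box_le n \<phi>) \<longleftrightarrow> (\<forall>w\<in>worlds F. sat F V w \<phi>)"
proof
  assume *: "sat F V 0 (box_le n \<phi>)"
  show "\<forall>w\<in>worlds F. sat F V w \<phi>"
  proof
    fix w assume "w \<in> worlds F"
    then obtain i where "i < card (worlds F)" "(0, w) \<in> acc F ^^ i"
      using assms relpow_less_card[of "worlds F" "acc F" 0 w] unfolding rooted_frame_def by blast
    moreover from this have "i \<le> n" using assms(3) by simp
    ultimately show "sat F V w \<phi>"
      using * unfolding sat_box_le by blast
  qed
next
  assume "\<forall>w\<in>worlds F. sat F V w \<phi>"
  then show "sat F V 0 (box_le n \<phi>)"
    using relpow_worlds[OF rooted_frame_acc[OF assms(2)] rooted_frame_root[OF assms(2)]]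
    unfolding sat_box_le by blast
qed

lemma sat_dia_le_root:
  assumes "finite (worlds F)" "rooted_frame F" "card (worlds F) \<le> n"
  shows "sat F V 0 (dia_le n \<phi>) \<longleftrightarrow> (\<exists>w\<in>worlds F. sat F V w \<phi>)"
  by (simp add: dia_le_def sat_box_le_root[OF assms])

lemma card_le_max_size: "finite FL \<Longrightarrow> F \<in> FL \<Longrightarrow> card (worlds F) \<le> max_size FL"
  unfolding max_size_def by (rule Max_ge) auto

text \<open>The variable \<open>(p, w)\<close> is read as truth of \<open>p\<close> at
  \<open>w\<close>. Finiteness gives the disjunction in the \<open>Dia\<close> case its intended
  meaning.\<close>

lemma peval_tr:
  assumes "finite (worlds F)" "acc F \<subseteq> worlds F \<times> worlds F"
  shows "peval (\<lambda>(p, w). V w p) (tr F w \<phi>) \<longleftrightarrow> sat F V w \<phi>"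
proof (induction \<phi> arbitrary: w)
  case (Dia \<phi>)
  have "finite {w'. (w, w') \<in> acc F}"
    using assms by (auto intro: finite_subset[of _ "worlds F"])
  then show ?case using Dia by (auto simp: peval_PBigOr)
qed auto


section \<open>Bisimulations and p-morphisms\<close>

text \<open>Invariance under bisimulation, applied below to the identity on a frame, the graph of a
  p-morphism and an abstract bisimulation.\<close>

lemma sat_bisim:
  assumes "(x, y) \<in> Z"
    and "\<And>x y p. (x, y) \<in> Z \<Longrightarrow> p \<in> sig \<phi> \<Longrightarrow> V x p \<longleftrightarrow> U y p"
    and "\<And>x y x'. (x, y) \<in> Z \<Longrightarrow> (x, x') \<in> acc F \<Longrightarrow> \<exists>y'. (y, y') \<in> acc G \<and> (x', y') \<in> Z"
    and "\<And>x y y'. (x, y) \<in> Z \<Longrightarrow> (y, y') \<in> acc G \<Longrightarrow> \<exists>x'. (x, x') \<in> acc F \<and> (x', y') \<in> Z"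
  shows "sat F V x \<phi> \<longleftrightarrow> sat G U y \<phi>"
  using assms(1,2)
proof (induction \<phi> arbitrary: x y)
  case (And \<phi>1 \<phi>2)
  then show ?case by (metis UnI1 UnI2 fm.set(4) sat.simps(4))
next
  case (Dia \<phi>)
  have IH: "sat F V x' \<phi> \<longleftrightarrow> sat G U y' \<phi>" if "(x', y') \<in> Z" for x' y'
    using Dia.IH[OF that] Dia.prems(2) by simp
  show ?case using IH assms(3,4)[OF Dia.prems(1)] by (metis sat.simps(5))
qed auto

lemma sat_cong:
  assumes "acc F \<subseteq> worlds F \<times> worlds F" "w \<in> worlds F"
    and "\<And>w p. w \<in> worlds F \<Longrightarrow> p \<in> sig \<phi> \<Longrightarrow> V w p \<longleftrightarrow> U w p"
  shows "sat F V w \<phi> \<longleftrightarrow> sat F U w \<phi>"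
  by (rule sat_bisim[of _ _ "Id_on (worlds F)"]) (use assms in auto)

text \<open>Surjectivity is built in: it makes a p-morphism from a finite frame to itself
  injective.\<close>

definition p_morphism :: "('v \<Rightarrow> 'w) \<Rightarrow> 'v frame \<Rightarrow> 'w frame \<Rightarrow> bool" where
  "p_morphism h H G \<longleftrightarrow>
     h ` worlds H = worlds G \<and>
     (\<forall>x y. (x, y) \<in> acc H \<longrightarrow> (h x, h y) \<in> acc G) \<and>
     (\<forall>x\<in>worlds H. \<forall>v. (h x, v) \<in> acc G \<longrightarrow> (\<exists>y. (x, y) \<in> acc H \<and> h y = v))"

lemma sat_p_morphism:
  assumes h: "p_morphism h H G" and "acc H \<subseteq> worlds H \<times> worlds H" "x \<in> worlds H"
    and "\<And>x p. x \<in> worlds H \<Longrightarrow> p \<in> sig \<phi> \<Longrightarrow> W x p \<longleftrightarrow> U (h x) p"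
  shows "sat H W x \<phi> \<longleftrightarrow> sat G U (h x) \<phi>"
proof (rule sat_bisim[of _ _ "{(x, h x) |x. x \<in> worlds H}"])
  show "\<exists>y'. (y, y') \<in> acc G \<and> (x', y') \<in> {(x, h x) |x. x \<in> worlds H}"
    if "(x, y) \<in> {(x, h x) |x. x \<in> worlds H}" "(x, x') \<in> acc H" for x y x'
    using that assms(2) h unfolding p_morphism_def by auto
  show "\<exists>x'. (x, x') \<in> acc H \<and> (x', y') \<in> {(x, h x) |x. x \<in> worlds H}"
    if "(x, y) \<in> {(x, h x) |x. x \<in> worlds H}" "(y, y') \<in> acc G" for x y y'
    using that assms(2) h unfolding p_morphism_def by fastforce
qed (use assms in auto)

lemma Log_p_morphism:
  fixes H G :: "'w::zero frame"
  assumes "p_morphism h H G" "rooted_frame H" "h 0 = 0" "sat H (\<lambda>x. U (h x)) 0 \<phi>"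
  shows "sat G U 0 \<phi>"
  using sat_p_morphism[OF assms(1) rooted_frame_acc rooted_frame_root, of \<phi> "\<lambda>x. U (h x)" U] assms
  by simp


section \<open>Diagrams\<close>

text \<open>The requirements that a Jankov-Fine formula places on a world named \<open>w\<close>,
  where \<open>q v\<close> is the name of \<open>v\<close>; the atoms in \<open>\<sigma>\<close> are
  prescribed too. The name \<open>q w\<close> itself is the antecedent in
  \<open>diagram\<close>.\<close>

definition world_diagram ::
    "'w frame \<Rightarrow> ('w \<Rightarrow> 'p \<Rightarrow> bool) \<Rightarrow> 'p set \<Rightarrow> ('w \<Rightarrow> 'p) \<Rightarrow> 'w \<Rightarrow> 'p fm" where
  "world_diagram G U \<sigma> q w = BigAnd
     ((\<lambda>v. Neg (Var (q v))) ` (worlds G - {w}) \<union>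
      (\<lambda>p. if U w p then Var p else Neg (Var p)) ` \<sigma> \<union>
      (\<lambda>v. Dia (Var (q v))) ` (acc G `` {w}) \<union>
      {Box (BigOr ((\<lambda>v. Var (q v)) ` (acc G `` {w})))})"

definition diagram ::
    "nat \<Rightarrow> 'w::zero frame \<Rightarrow> ('w \<Rightarrow> 'p \<Rightarrow> bool) \<Rightarrow> 'p set \<Rightarrow> ('w \<Rightarrow> 'p) \<Rightarrow> 'p fm" where
  "diagram n G U \<sigma> q = And (Var (q 0))
     (box_le n (BigAnd ((\<lambda>w. Imp (Var (q w)) (world_diagram G U \<sigma> q w)) ` worlds G)))"

lemma finite_successors:
  "finite (worlds G) \<Longrightarrow> acc G \<subseteq> worlds G \<times> worlds G \<Longrightarrow> finite (acc G `` {w})"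
  by (auto intro: finite_subset[of _ "worlds G"])

lemma sat_world_diagram:
  assumes "finite (worlds G)" "acc G \<subseteq> worlds G \<times> worlds G" "finite \<sigma>"
  shows "sat H W x (world_diagram G U \<sigma> q w) \<longleftrightarrow>
     (\<forall>v\<in>worlds G - {w}. \<not> W x (q v)) \<and>
     (\<forall>p\<in>\<sigma>. W x p \<longleftrightarrow> U w p) \<and>
     (\<forall>v. (w, v) \<in> acc G \<longrightarrow> (\<exists>y. (x, y) \<in> acc H \<and> W y (q v))) \<and>
     (\<forall>y. (x, y) \<in> acc H \<longrightarrow> (\<exists>v. (w, v) \<in> acc G \<and> W y (q v)))"
  using assms finite_successors[OF assms(1,2), of w] unfolding world_diagram_def
  by (auto simp: sat_BigAnd sat_BigOr ball_Un)

lemma sig_diagram: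
  fixes G :: "'w::zero frame"
  assumes "finite (worlds G)" "rooted_frame G" "finite \<sigma>"
  shows "sig (diagram n G U \<sigma> q) \<subseteq> \<sigma> \<union> q ` worlds G"
proof -
  note acc = rooted_frame_acc[OF assms(2)] and root = rooted_frame_root[OF assms(2)]
  have "sig (world_diagram G U \<sigma> q w) \<subseteq> \<sigma> \<union> q ` worlds G" for w
    using assms acc finite_successors[OF assms(1) acc, of w] unfolding world_diagram_def
    by (auto simp: sig_BigAnd sig_BigOr)
  then show ?thesis
    using assms root unfolding diagram_def by (auto simp: sig_BigAnd sig_box_le)
qed

text \<open>Injectivity of \<open>q\<close> separates the names, and disjointness from
  \<open>\<sigma>\<close> keeps the values prescribed by \<open>U\<close> from overriding
  them.\<close>

lemma sat_diagram_self:
  fixes G :: "'w::zero frame"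
  assumes "finite (worlds G)" "rooted_frame G" "card (worlds G) \<le> n" "finite \<sigma>"
    and "inj_on q (worlds G)" "q ` worlds G \<inter> \<sigma> = {}"
  shows "sat G (\<lambda>w p. if p \<in> \<sigma> then U w p else p = q w) 0 (diagram n G U \<sigma> q)"
proof -
  note acc = rooted_frame_acc[OF assms(2)] and root = rooted_frame_root[OF assms(2)]
  have q: "q w \<notin> \<sigma>" if "w \<in> worlds G" for w using that assms(6) by auto
  show ?thesis
    using assms(1,5) q root acc unfolding diagram_def
    by (auto simp: sat_box_le_root[OF assms(1-3)] sat_BigAnd
        sat_world_diagram[OF assms(1) acc assms(4)] dest: inj_onD)
qed

text \<open>The map sends \<open>x\<close> to the unique world of \<open>G\<close> whose name is
  true at \<open>x\<close>.\<close>

lemma sat_diagram_p_morphism: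
  fixes G H :: "'w::zero frame"
  assumes G: "finite (worlds G)" "rooted_frame G" and "finite \<sigma>"
    and H: "finite (worlds H)" "rooted_frame H" "card (worlds H) \<le> n"
    and sat: "sat H W 0 (diagram n G U \<sigma> q)"
  obtains h where "p_morphism h H G" "h 0 = 0"
    and "\<And>x p. x \<in> worlds H \<Longrightarrow> p \<in> \<sigma> \<Longrightarrow> W x p \<longleftrightarrow> U (h x) p"
proof -
  note accG = rooted_frame_acc[OF G(2)] and accH = rooted_frame_acc[OF H(2)]
  note rootG = rooted_frame_root[OF G(2)] and rootH = rooted_frame_root[OF H(2)]
  have q0: "W 0 (q 0)"
    using sat by (simp add: diagram_def)
  have "\<forall>x\<in>worlds H. \<forall>w\<in>worlds G. W x (q w) \<longrightarrow> sat H W x (world_diagram G U \<sigma> q w)"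
    using sat G(1) by (auto simp: diagram_def sat_box_le_root[OF H] sat_BigAnd)
  then have
      unique: "\<And>x w v. \<lbrakk>x \<in> worlds H; w \<in> worlds G; W x (q w); v \<in> worlds G; W x (q v)\<rbrakk> \<Longrightarrow> v = w"
    and atoms: "\<And>x w p. \<lbrakk>x \<in> worlds H; w \<in> worlds G; W x (q w); p \<in> \<sigma>\<rbrakk> \<Longrightarrow> W x p \<longleftrightarrow> U w p"
    and zag: "\<And>x w v. \<lbrakk>x \<in> worlds H; w \<in> worlds G; W x (q w); (w, v) \<in> acc G\<rbrakk> \<Longrightarrow>
      \<exists>y. (x, y) \<in> acc H \<and> W y (q v)"
    and zig: "\<And>x w y. \<lbrakk>x \<in> worlds H; w \<in> worlds G; W x (q w); (x, y) \<in> acc H\<rbrakk> \<Longrightarrow>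
      \<exists>v. (w, v) \<in> acc G \<and> W y (q v)"
    unfolding sat_world_diagram[OF G(1) accG assms(3)] by blast+
  \<comment> \<open>Names spread from the root of \<open>H\<close> along its paths, since every
    successor of a named world is named.\<close>
  have named: "\<exists>w\<in>worlds G. W x (q w)" if "x \<in> worlds H" for x
  proof -
    have "(0, x) \<in> (acc H)\<^sup>*"
      using H(2) that by (simp add: rooted_frame_def)
    then show ?thesis
    proof (induction rule: rtrancl_induct)
      case base
      then show ?case using q0 rootG by blast
    next
      case (step x y)
      then show ?case using zig accG accH by blast
    qed
  qed
  define h where "h x = (THE w. w \<in> worlds G \<and> W x (q w))" for x
  have h_eq: "h x = w" if "x \<in> worlds H" "w \<in> worlds G" "W x (q w)" for x w
    unfolding h_def using that unique by (intro the_equality) auto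
  have h: "h x \<in> worlds G" "W x (q (h x))" if "x \<in> worlds H" for x
    using named[OF that] h_eq[OF that] by auto
  \<comment> \<open>Conversely, paths of \<open>G\<close> from the root are lifted to
    \<open>H\<close>.\<close>
  have surj: "w \<in> h ` worlds H" if "w \<in> worlds G" for w
  proof -
    have "(0, w) \<in> (acc G)\<^sup>*"
      using G(2) that by (simp add: rooted_frame_def)
    then show ?thesis
    proof (induction rule: rtrancl_induct)
      case base
      then show ?case using h_eq[OF rootH rootG q0] rootH by force
    next
      case (step w v)
      then obtain x where x: "x \<in> worlds H" "w = h x" by blast
      then obtain y where "(x, y) \<in> acc H" "W y (q v)"
        using zag[OF x(1)] h step.hyps(2) by blast
      then show ?case using h_eq[of y v] accH accG step.hyps(2) by blast
    qed
  qed
  have "p_morphism h H G"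
    unfolding p_morphism_def
  proof (intro conjI allI ballI impI)
    show "h ` worlds H = worlds G" using h surj by blast
    show "(h x, h y) \<in> acc G" if xy: "(x, y) \<in> acc H" for x y
    proof -
      have x: "x \<in> worlds H" and y: "y \<in> worlds H" using xy accH by auto
      obtain v where "(h x, v) \<in> acc G" "W y (q v)"
        using zig[OF x h[OF x] xy] by blast
      then show ?thesis using h_eq[OF y, of v] accG by auto
    qed
    show "\<exists>y. (x, y) \<in> acc H \<and> h y = v" if "x \<in> worlds H" "(h x, v) \<in> acc G" for x v
      using zag[OF that(1) h[OF that(1)] that(2)] h_eq that accG accH by blast
  qed
  moreover have "h 0 = 0" using h_eq[OF rootH rootG q0] .
  ultimately show thesis using that atoms h by blast
qed

text \<open>Supplies the fresh names of worlds; here the infinite supply of variables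
  enters.\<close>

lemma ex_inj_on_avoiding:
  fixes S :: "'p::infinite set"
  assumes "finite W" "finite S"
  obtains q :: "'w \<Rightarrow> 'p" where "inj_on q W" "q ` W \<inter> S = {}"
proof -
  have "infinite (- S)"
    using assms(2) infinite_UNIV by (metis finite_compl)
  then obtain B where B: "finite B" "card B = card W" "B \<subseteq> - S"
    using infinite_arbitrarily_large by blast
  then obtain q where "bij_betw q W B"
    using finite_same_card_bij[OF assms(1) B(1)] by auto
  then show thesis
    using B(3) by (intro that[of q]) (auto simp: bij_betw_def)
qed

lemma refuting_expansion:
  fixes FL :: "'w::zero frame set" and \<psi> :: "'p::infinite fm"
  assumes FL: "finite FL" "\<And>F. F \<in> FL \<Longrightarrow> finite (worlds F) \<and> rooted_frame F"
    and irredundant: "\<And>FL'. FL' \<subset> FL \<Longrightarrow> Log FL' \<noteq> (Log FL :: 'p fm set)"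
    and craig: "craig_property (Log FL :: 'p fm set)"
    and F: "F \<in> FL" "\<not> sat F V 0 \<psi>"
    and G: "G \<in> FL"
    and \<sigma>: "\<sigma> \<subseteq> sig \<psi>"
    and same_theory: "\<And>\<theta>. sig \<theta> \<subseteq> \<sigma> \<Longrightarrow> sat F V 0 \<theta> \<longleftrightarrow> sat G U 0 \<theta>"
  obtains U' where "\<And>w p. w \<in> worlds G \<Longrightarrow> p \<in> \<sigma> \<Longrightarrow> U' w p \<longleftrightarrow> U w p" "\<not> sat G U' 0 \<psi>"
proof -
  define n where "n = max_size FL"
  have n: "card (worlds H) \<le> n" if "H \<in> FL" for H
    unfolding n_def using FL(1) that by (rule card_le_max_size)
  have G': "finite (worlds G)" "rooted_frame G" using FL(2)[OF G] by auto
  have fin\<sigma>: "finite \<sigma>" using \<sigma> finite_sig finite_subset by blast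
  obtain q :: "'w \<Rightarrow> 'p" where q: "inj_on q (worlds G)" "q ` worlds G \<inter> sig \<psi> = {}"
    using ex_inj_on_avoiding[OF G'(1) finite_sig] by blast
  let ?\<beta> = "diagram n G U \<sigma> q"
  have "Imp (Neg \<psi>) (Neg ?\<beta>) \<notin> Log FL"
  proof
    assume "Imp (Neg \<psi>) (Neg ?\<beta>) \<in> Log FL"
    then obtain \<theta> where \<theta>: "Imp (Neg \<psi>) \<theta> \<in> Log FL" "Imp \<theta> (Neg ?\<beta>) \<in> Log FL"
        "sig \<theta> \<subseteq> sig \<psi> \<inter> sig ?\<beta>"
      using craig unfolding craig_property_def craig_interpolant_def by fastforce
    have sig: "sig \<theta> \<subseteq> \<sigma>"
      using \<theta>(3) sig_diagram[OF G' fin\<sigma>, of n U q] q(2) by blast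
    \<comment> \<open>Since \<open>\<theta>\<close> sees only \<open>\<sigma>\<close>, the valuation
      \<open>U\<close> may be redefined elsewhere so that the names are interpreted as
      intended.\<close>
    let ?D = "\<lambda>w p. if p \<in> \<sigma> then U w p else p = q w"
    have "sat F V 0 \<theta>"
      using \<theta>(1) F by (auto simp: Log_def)
    then have "sat G U 0 \<theta>"
      using same_theory[OF sig] by blast
    moreover have "sat G U 0 \<theta> \<longleftrightarrow> sat G ?D 0 \<theta>"
      using sig by (intro sat_cong[OF rooted_frame_acc rooted_frame_root] G'(2)) auto
    moreover have "sat G ?D 0 ?\<beta>"
      using q \<sigma> by (intro sat_diagram_self[OF G' n[OF G] fin\<sigma>]) auto
    ultimately show False
      using \<theta>(2) G by (auto simp: Log_def)
  qed
  then obtain H W where H: "H \<in> FL" "\<not> sat H W 0 \<psi>" "sat H W 0 ?\<beta>"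
    unfolding Log_def by auto
  then have H': "finite (worlds H)" "rooted_frame H" using FL(2) by auto
  obtain h where h: "p_morphism h H G" "h 0 = 0"
      "\<And>x p. x \<in> worlds H \<Longrightarrow> p \<in> \<sigma> \<Longrightarrow> W x p \<longleftrightarrow> U (h x) p"
    using sat_diagram_p_morphism[OF G' fin\<sigma> H' n[OF H(1)] H(3)] by blast
  have "H = G"
  proof (rule ccontr)
    assume "H \<noteq> G"
    \<comment> \<open>\<open>H\<close> is still a member of \<open>FL - {G}\<close>, and its
      validities pass to \<open>G\<close>.\<close>
    then have "Log (FL - {G}) \<subseteq> (Log FL :: 'p fm set)"
      using H(1) Log_p_morphism[OF h(1) H'(2) h(2)] unfolding Log_def by blast
    then have "Log (FL - {G}) = (Log FL :: 'p fm set)"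
      unfolding Log_def by blast
    then show False using irredundant[of "FL - {G}"] G by blast
  qed
  then have hG: "p_morphism h G G" using h(1) by simp
  then have "inj_on h (worlds G)"
    using G'(1) by (intro eq_card_imp_inj_on) (auto simp: p_morphism_def)
  \<comment> \<open>\<open>W\<close> agrees on \<open>\<sigma>\<close> with \<open>U\<close> only up
    to \<open>h\<close>; moving it along the inverse of \<open>h\<close> gives agreement at the same
    world.\<close>
  define U' where "U' w = W (inv_into (worlds G) h w)" for w
  have U'h: "U' (h x) = W x" if "x \<in> worlds G" for x
    unfolding U'_def using \<open>inj_on h (worlds G)\<close> that by simp
  have "sat G W 0 \<psi> \<longleftrightarrow> sat G U' (h 0) \<psi>"
    by (rule sat_p_morphism[OF hG rooted_frame_acc[OF G'(2)] rooted_frame_root[OF G'(2)]])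
      (simp add: U'h)
  then have "\<not> sat G U' 0 \<psi>"
    using H(2) h(2) \<open>H = G\<close> by simp
  moreover have "U' w p \<longleftrightarrow> U w p" if "w \<in> worlds G" "p \<in> \<sigma>" for w p
  proof -
    have "w \<in> h ` worlds G"
      using hG that(1) by (simp add: p_morphism_def)
    then obtain x where "x \<in> worlds G" "w = h x" by auto
    then show ?thesis using U'h h(3)[of x p] that(2) unfolding \<open>H = G\<close> by simp
  qed
  ultimately show thesis using that by blast
qed


section \<open>Covers and abstract models\<close>

text \<open>The restricted abstraction makes the labelling extensional, as \<open>abs_models\<close>
  demands; \<open>EME_ex1\<close> makes the description proper.\<close>

definition label :: "'p pl set \<Rightarrow> 'w frame \<Rightarrow> ('w \<Rightarrow> 'p \<Rightarrow> bool) \<Rightarrow> 'w \<Rightarrow> 'p pl" where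
  "label \<Phi> F V = (\<lambda>w\<in>worlds F. THE \<alpha>. \<alpha> \<in> \<Phi> \<and> peval (V w) \<alpha>)"

lemma sat_emb: "sat F V w (emb \<alpha>) \<longleftrightarrow> peval (V w) \<alpha>"
  by (simp add: sat_psubst)

lemma EME_ex1:
  assumes "EME \<sigma> \<Phi>"
  shows "\<exists>!\<alpha>. \<alpha> \<in> \<Phi> \<and> peval v \<alpha>"
proof -
  have "\<exists>\<alpha>\<in>\<Phi>. peval v \<alpha>"
    using assms by (auto simp: EME_def taut_def peval_PBigOr)
  moreover have "\<alpha> = \<alpha>'" if "\<alpha> \<in> \<Phi>" "\<alpha>' \<in> \<Phi>" "peval v \<alpha>" "peval v \<alpha>'" for \<alpha> \<alpha>'
    using assms that unfolding EME_def taut_def by (metis peval.simps(3,4))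
  ultimately show ?thesis by blast
qed

lemma label_eq_iff:
  assumes "EME \<sigma> \<Phi>" "w \<in> worlds F" "\<alpha> \<in> \<Phi>"
  shows "label \<Phi> F V w = \<alpha> \<longleftrightarrow> peval (V w) \<alpha>"
  using theI'[OF EME_ex1[OF assms(1), of "V w"]] EME_ex1[OF assms(1), of "V w"] assms(2,3)
  by (auto simp: label_def)

lemma label_in: "EME \<sigma> \<Phi> \<Longrightarrow> label \<Phi> F V \<in> worlds F \<rightarrow>\<^sub>E \<Phi>"
  using theI'[OF EME_ex1] by (auto simp: label_def)

text \<open>Each conjunct transfers truth of \<open>p\<close> between worlds satisfying
  \<open>\<alpha>\<close>; exchanging the two worlds transfers falsity.\<close>

lemma sat_cover:
  assumes "finite (worlds F)" "rooted_frame F" "card (worlds F) \<le> n" "finite \<Phi>" "finite \<sigma>"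
  shows "sat F V 0 (cover n \<sigma> \<Phi>) \<longleftrightarrow>
    (\<forall>\<alpha>\<in>\<Phi>. \<forall>w\<in>worlds F. \<forall>w'\<in>worlds F. peval (V w) \<alpha> \<and> peval (V w') \<alpha> \<longrightarrow>
       (\<forall>p\<in>\<sigma>. V w p \<longleftrightarrow> V w' p))"
  using assms(4,5) unfolding cover_def
  by (simp add: sat_BigAnd sat_emb sat_dia_le_root[OF assms(1-3)] sat_box_le_root[OF assms(1-3)])
    blast

text \<open>By the cover, all worlds with the label of \<open>w\<close> agree with \<open>w\<close>
  on \<open>p\<close>, so one of them satisfies \<open>p\<close> iff \<open>w\<close> does.\<close>

lemma sat_dia_le_label:
  assumes F: "finite (worlds F)" "rooted_frame F" "card (worlds F) \<le> n"
    and "EME \<sigma> \<Phi>" "finite \<sigma>" "sat F V 0 (cover n \<sigma> \<Phi>)" "w \<in> worlds F" "p \<in> \<sigma>"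
  shows "sat F V 0 (dia_le n (And (emb (label \<Phi> F V w)) (Var p))) \<longleftrightarrow> V w p"
proof -
  have \<Phi>: "finite \<Phi>" using assms(4) by (simp add: EME_def)
  have in\<Phi>: "label \<Phi> F V w \<in> \<Phi>" using label_in[OF assms(4)] assms(7) by (rule PiE_mem)
  have "peval (V w) (label \<Phi> F V w)" using label_eq_iff[OF assms(4,7) in\<Phi>] by blast
  moreover have "\<forall>w'\<in>worlds F. peval (V w) (label \<Phi> F V w) \<and> peval (V w') (label \<Phi> F V w) \<longrightarrow>
      (V w p \<longleftrightarrow> V w' p)"
    using assms(6-8) in\<Phi> unfolding sat_cover[OF F \<Phi> assms(5)] by blast
  ultimately show ?thesis
    unfolding sat_dia_le_root[OF F] sat.simps sat_emb using assms(7) by blast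
qed

text \<open>The atoms of \<open>\<delta>\<close> belong to \<open>\<Phi>\<close>, and for these
  being the label of a world and being true there coincide.\<close>

lemma label_in_abs_class:
  assumes "F \<in> FL" "rooted_frame F" "EME \<sigma> \<Phi>" "class_identifier FL \<Phi> \<delta>" "sat F V 0 (unabs \<delta>)"
  shows "(F, label \<Phi> F V) \<in> abs_class FL \<Phi> \<delta>"
proof -
  have "sig \<delta> \<subseteq> \<Phi>" using assms(4) by (simp add: class_identifier_def)
  then have "sat F (\<lambda>u \<alpha>. peval (V u) \<alpha>) 0 \<delta> \<longleftrightarrow> sat F (\<lambda>u \<alpha>. label \<Phi> F V u = \<alpha>) 0 \<delta>"
    by (intro sat_cong[OF rooted_frame_acc rooted_frame_root] assms(2))
      (simp add: label_eq_iff[OF assms(3)] subset_iff)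
  then show ?thesis
    using assms label_in[OF assms(3)]
    by (simp add: abs_class_def abs_models_def abs_sat_def unabs_def sat_subst sat_emb)
qed

text \<open>The valuation at a world is determined by its label, so that abstract bisimulations are
  bisimulations for all variables.\<close>

lemma sat_abs_bisimilar:
  fixes M M' :: "('w::zero, 'p) abs_model"
  assumes "abs_bisimilar M M'"
  shows "sat (fst M) (\<lambda>w. B (snd M w)) 0 \<theta> \<longleftrightarrow> sat (fst M') (\<lambda>w. B (snd M' w)) 0 \<theta>"
proof -
  obtain Z where Z: "abs_bisim M M' Z" "(0, 0) \<in> Z"
    using assms unfolding abs_bisimilar_def by blast
  show ?thesis
    by (rule sat_bisim[OF Z(2)]) (use Z(1) in \<open>force simp: abs_bisim_def\<close>)+
qed

text \<open>Both models are bisimilar to the representative \<open>K\<close> of the class.\<close>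

lemma sat_abs_class:
  fixes M M' :: "('w::zero, 'p) abs_model"
  assumes "class_identifier FL \<Phi> \<delta>" "M \<in> abs_class FL \<Phi> \<delta>" "M' \<in> abs_class FL \<Phi> \<delta>"
  shows "sat (fst M) (\<lambda>w. B (snd M w)) 0 \<theta> \<longleftrightarrow> sat (fst M') (\<lambda>w. B (snd M' w)) 0 \<theta>"
proof -
  obtain K where "abs_class FL \<Phi> \<delta> = {M \<in> abs_models FL \<Phi>. abs_bisimilar K M}"
    using assms(1) unfolding class_identifier_def by blast
  then have "abs_bisimilar K M" "abs_bisimilar K M'" using assms(2,3) by auto
  from sat_abs_bisimilar[OF this(1), of B \<theta>] sat_abs_bisimilar[OF this(2), of B \<theta>]
  show ?thesis by simp
qed

section \<open>The formula \<open>rt\<close>: truth conditions and signature\<close>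

lemma finite_abs_inst:
  assumes "finite (worlds F)" "finite \<Phi>"
  shows "finite {abs_inst n f \<xi> |f. (F, f) \<in> abs_class FL \<Phi> \<delta>}"
proof -
  \<comment> \<open>Extensionality confines \<open>f\<close> to a finite function space.\<close>
  have "{abs_inst n f \<xi> |f. (F, f) \<in> abs_class FL \<Phi> \<delta>} \<subseteq> (\<lambda>f. abs_inst n f \<xi>) ` (worlds F \<rightarrow>\<^sub>E \<Phi>)"
    by (auto simp: abs_class_def abs_models_def)
  then show ?thesis
    using assms by (elim finite_subset) (simp_all add: finite_PiE)
qed

lemma sat_abs_inst:
  "sat F V 0 (abs_inst n f \<xi>) \<longleftrightarrow>
     peval (\<lambda>(p, w). sat F V 0 (dia_le n (And (emb (f w)) (Var p)))) \<xi>"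
  unfolding abs_inst_def sat_psubst by (simp add: case_prod_unfold)

lemma sat_rt:
  fixes FL :: "'w::zero frame set"
  assumes "encoding FL \<sigma> \<Gamma> \<Delta>" "finite (worlds G)"
  shows "sat F V w (rt FL \<sigma> \<Gamma> \<Delta> G \<xi>) \<longleftrightarrow>
    (\<forall>\<Phi>\<in>\<Gamma>. \<forall>\<delta>\<in>\<Delta> \<Phi>.
       sat F V w (cover (max_size FL) \<sigma> \<Phi>) \<and> sat F V w (unabs \<delta>) \<longrightarrow>
       (\<exists>f. (G, f) \<in> abs_class FL \<Phi> \<delta> \<and> sat F V w (abs_inst (max_size FL) f \<xi>)))"
proof -
  have fin: "finite \<Gamma>" "\<And>\<Phi>. \<Phi> \<in> \<Gamma> \<Longrightarrow> finite (\<Delta> \<Phi>)" "\<And>\<Phi>. \<Phi> \<in> \<Gamma> \<Longrightarrow> finite \<Phi>"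
    using assms(1) by (auto simp: encoding_def EME_def)
  have "sat F V w (BigOr {abs_inst n f \<xi> |f. (G, f) \<in> abs_class FL \<Phi> \<delta>}) \<longleftrightarrow>
      (\<exists>f. (G, f) \<in> abs_class FL \<Phi> \<delta> \<and> sat F V w (abs_inst n f \<xi>))" if "\<Phi> \<in> \<Gamma>" for \<Phi> \<delta> n
    unfolding sat_BigOr[OF finite_abs_inst[OF assms(2) fin(3)[OF that]]] by blast
  then show ?thesis
    using fin unfolding rt_def by (simp add: sat_BigAnd cong: ball_cong) blast
qed

lemma sig_rt:
  fixes FL :: "'w::zero frame set"
  assumes "encoding FL \<sigma> \<Gamma> \<Delta>" "finite (worlds G)" "finite \<sigma>" "psig \<xi> \<subseteq> \<sigma> \<times> worlds G"
  shows "sig (rt FL \<sigma> \<Gamma> \<Delta> G \<xi>) \<subseteq> \<sigma>"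
proof -
  have fin: "finite \<Gamma>" "\<And>\<Phi>. \<Phi> \<in> \<Gamma> \<Longrightarrow> finite (\<Delta> \<Phi>)" "\<And>\<Phi>. \<Phi> \<in> \<Gamma> \<Longrightarrow> finite \<Phi>"
    and psig: "\<And>\<Phi> \<alpha>. \<Phi> \<in> \<Gamma> \<Longrightarrow> \<alpha> \<in> \<Phi> \<Longrightarrow> psig \<alpha> \<subseteq> \<sigma>"
    and sig: "\<And>\<Phi> \<delta>. \<Phi> \<in> \<Gamma> \<Longrightarrow> \<delta> \<in> \<Delta> \<Phi> \<Longrightarrow> sig \<delta> \<subseteq> \<Phi>"
    using assms(1) by (auto simp: encoding_def EME_def class_identifier_def)
  have "sig (cover n \<sigma> \<Phi>) \<subseteq> \<sigma>" if "\<Phi> \<in> \<Gamma>" for \<Phi> n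
    using fin(3)[OF that] assms(3) psig[OF that] unfolding cover_def
    by (fastforce simp: sig_BigAnd sig_dia_le sig_box_le sig_psubst)
  moreover have "sig (unabs \<delta>) \<subseteq> \<sigma>" if "\<Phi> \<in> \<Gamma>" "\<delta> \<in> \<Delta> \<Phi>" for \<Phi> \<delta>
    using sig[OF that] psig[OF that(1)] unfolding unabs_def
    by (auto simp: sig_subst sig_psubst)
  moreover have "sig (BigOr {abs_inst n f \<xi> |f. (G, f) \<in> abs_class FL \<Phi> \<delta>}) \<subseteq> \<sigma>"
    if "\<Phi> \<in> \<Gamma>" for \<Phi> \<delta> n
  proof -
    have "sig (abs_inst n f \<xi>) \<subseteq> \<sigma>" if "(G, f) \<in> abs_class FL \<Phi> \<delta>" for f
    proof -
      \<comment> \<open>Off the worlds \<open>f\<close> is \<open>undefined\<close>; the bound on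
        \<open>psig \<xi>\<close> keeps that value out of the formula.\<close>
      have "f w \<in> \<Phi>" if "w \<in> worlds G" for w
        using \<open>(G, f) \<in> _\<close> that by (auto simp: abs_class_def abs_models_def)
      then show ?thesis
        using assms(4) psig[OF \<open>\<Phi> \<in> \<Gamma>\<close>] unfolding abs_inst_def
        by (fastforce simp: sig_psubst sig_dia_le)
    qed
    then show ?thesis
      unfolding sig_BigOr[OF finite_abs_inst[OF assms(2) fin(3)[OF that]]] by blast
  qed
  ultimately show ?thesis
    using fin unfolding rt_def by (simp add: sig_BigAnd UN_subset_iff)
qed


section \<open>The interpolant\<close>

text \<open>For every \<open>\<Phi>\<close> and \<open>\<delta>\<close> whose premise holds, the
  model's own labelling provides a true disjunct.\<close>

lemma sat_rt_of_sat:
  fixes FL :: "'w::zero frame set"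
  assumes FL: "finite FL" "finite (worlds F)" "rooted_frame F" "F \<in> FL"
    and enc: "encoding FL \<sigma> \<Gamma> \<Delta>" and "finite \<sigma>" "psig \<xi> \<subseteq> \<sigma> \<times> worlds F"
    and \<xi>: "taut (PImp (tr F 0 \<phi>) \<xi>)" and sat: "sat F V 0 \<phi>"
  shows "sat F V 0 (rt FL \<sigma> \<Gamma> \<Delta> F \<xi>)"
  unfolding sat_rt[OF enc FL(2)]
proof (intro ballI impI, elim conjE)
  let ?n = "max_size FL"
  fix \<Phi> \<delta> assume "\<Phi> \<in> \<Gamma>" "\<delta> \<in> \<Delta> \<Phi>"
    and cov: "sat F V 0 (cover ?n \<sigma> \<Phi>)" and \<delta>: "sat F V 0 (unabs \<delta>)"
  then have \<Phi>: "EME \<sigma> \<Phi>" "class_identifier FL \<Phi> \<delta>"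
    using enc by (auto simp: encoding_def)
  have "peval (\<lambda>(p, w). V w p) \<xi>"
    using \<xi> sat peval_tr[OF FL(2) rooted_frame_acc[OF FL(3)], of V 0 \<phi>] by (auto simp: taut_def)
  moreover have "sat F V 0 (abs_inst ?n (label \<Phi> F V) \<xi>) \<longleftrightarrow> peval (\<lambda>(p, w). V w p) \<xi>"
    unfolding sat_abs_inst
    using sat_dia_le_label[OF FL(2,3) card_le_max_size[OF FL(1,4)] \<Phi>(1) assms(6) cov] assms(7)
    by (intro peval_cong) auto
  ultimately show "\<exists>f. (F, f) \<in> abs_class FL \<Phi> \<delta> \<and> sat F V 0 (abs_inst ?n f \<xi>)"
    using label_in_abs_class[OF FL(4,3) \<Phi> \<delta>] by blast
qed

text \<open>The identifier true in \<open>(F, V)\<close> puts the labelled frame \<open>F\<close>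
  and an abstract model on \<open>G\<close> into one class, and bisimilarity carries the
  \<open>\<sigma>\<close>-theory across.\<close>

lemma same_theory_of_sat_rt:
  fixes FL :: "'w::zero frame set"
  assumes FL: "finite FL" "\<And>F. F \<in> FL \<Longrightarrow> finite (worlds F) \<and> rooted_frame F"
    and enc: "encoding FL \<sigma> \<Gamma> \<Delta>" and \<sigma>: "finite \<sigma>"
    and F: "F \<in> FL" and G: "G \<in> FL" and sat: "sat F V 0 (rt FL \<sigma> \<Gamma> \<Delta> G \<xi>)"
  obtains U where "peval (\<lambda>(p, w). U w p) \<xi>"
    and "\<And>\<theta>. sig \<theta> \<subseteq> \<sigma> \<Longrightarrow> sat F V 0 \<theta> \<longleftrightarrow> sat G U 0 \<theta>"
proof -
  let ?n = "max_size FL"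
  have F': "finite (worlds F)" "rooted_frame F" "card (worlds F) \<le> ?n"
    using FL(2)[OF F] card_le_max_size[OF FL(1) F] by auto
  obtain \<Phi> \<delta> where \<Phi>: "\<Phi> \<in> \<Gamma>" "is_cover \<sigma> \<Phi> F V" and \<delta>: "\<delta> \<in> \<Delta> \<Phi>" "sat F V 0 (unabs \<delta>)"
    using enc F unfolding encoding_def by blast
  have EME: "EME \<sigma> \<Phi>" and id: "class_identifier FL \<Phi> \<delta>"
    using enc \<Phi>(1) \<delta>(1) by (auto simp: encoding_def)
  then have "finite \<Phi>" by (simp add: EME_def)
  then have cov: "sat F V 0 (cover ?n \<sigma> \<Phi>)"
    using \<Phi>(2) unfolding sat_cover[OF F' \<open>finite \<Phi>\<close> \<sigma>] is_cover_def sat_emb by blast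
  obtain f where f: "(G, f) \<in> abs_class FL \<Phi> \<delta>" "sat F V 0 (abs_inst ?n f \<xi>)"
    using sat \<Phi>(1) \<delta> cov unfolding sat_rt[OF enc conjunct1[OF FL(2)[OF G]]] by blast
  \<comment> \<open>\<open>B \<alpha>\<close> reads off, at the root of \<open>(F, V)\<close>, the
    atoms of the worlds labelled \<open>\<alpha>\<close>. As it depends on the label alone, it
    induces valuations on both \<open>F\<close> and \<open>G\<close>.\<close>
  define B where "B \<alpha> p \<longleftrightarrow> sat F V 0 (dia_le ?n (And (emb \<alpha>) (Var p)))" for \<alpha> p
  have "sat F V 0 \<theta> \<longleftrightarrow> sat G (\<lambda>w. B (f w)) 0 \<theta>" if "sig \<theta> \<subseteq> \<sigma>" for \<theta>
  proof -
    \<comment> \<open>On \<open>F\<close> the induced valuation is \<open>V\<close> again, as far as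
      \<open>\<sigma>\<close> is concerned.\<close>
    have "sat F V 0 \<theta> \<longleftrightarrow> sat F (\<lambda>w. B (label \<Phi> F V w)) 0 \<theta>"
      using sat_dia_le_label[OF F' EME \<sigma> cov] that unfolding B_def
      by (intro sat_cong[OF rooted_frame_acc rooted_frame_root] F'(2)) auto
    also have "\<dots> \<longleftrightarrow> sat G (\<lambda>w. B (f w)) 0 \<theta>"
      using sat_abs_class[OF id label_in_abs_class[OF F F'(2) EME id \<delta>(2)] f(1), of B \<theta>] by simp
    finally show ?thesis .
  qed
  moreover have "peval (\<lambda>(p, w). B (f w) p) \<xi>"
    using f(2) by (simp add: sat_abs_inst B_def)
  ultimately show thesis using that[of "\<lambda>w. B (f w)"] by blast
qed

theorem theorem5p2:
  fixes FL :: "'w::zero frame set"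
    and L :: "'p::infinite fm set"
    and \<phi> \<psi> :: "'p fm"
    and \<sigma> :: "'p set"
    and \<Gamma> :: "'p pl set set"
    and \<Delta> :: "'p pl set \<Rightarrow> 'p pl fm set"
    and \<xi> :: "'w frame \<Rightarrow> ('p \<times> 'w) pl"
  assumes "finite FL"
    and "\<And>F. F \<in> FL \<Longrightarrow> finite (worlds F) \<and> rooted_frame F"
    and "L = Log FL"
    and "\<And>FL'. FL' \<subset> FL \<Longrightarrow> Log FL' \<noteq> L"
    and "quasi_normal L"
    and "craig_property L"
    and "Imp \<phi> \<psi> \<in> L"
    and "\<sigma> = sig \<phi> \<inter> sig \<psi>"
    and "encoding FL \<sigma> \<Gamma> \<Delta>"
    and "\<And>F. F \<in> FL \<Longrightarrow> psig (\<xi> F) \<subseteq> \<sigma> \<times> worlds F"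
    and "\<And>F. F \<in> FL \<Longrightarrow> prop_craig_interpolant (tr F 0 \<phi>) (tr F 0 \<psi>) (\<xi> F)"
  shows "craig_interpolant L \<phi> \<psi> (BigOr ((\<lambda>F. rt FL \<sigma> \<Gamma> \<Delta> F (\<xi> F)) ` FL))"
proof -
  let ?\<chi> = "BigOr ((\<lambda>F. rt FL \<sigma> \<Gamma> \<Delta> F (\<xi> F)) ` FL)"
  note FL = assms(1,2)
  note minimal = assms(4)[unfolded assms(3)] and craig = assms(6)[unfolded assms(3)]
  note enc = assms(9) and interp = assms(11)[unfolded prop_craig_interpolant_def]
  have \<sigma>: "finite \<sigma>" "\<sigma> \<subseteq> sig \<psi>"
    using assms(8) finite_sig by auto
  have sat\<chi>: "sat F V 0 ?\<chi> \<longleftrightarrow> (\<exists>G\<in>FL. sat F V 0 (rt FL \<sigma> \<Gamma> \<Delta> G (\<xi> G)))" for F :: "'w frame" and V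
    using FL(1) by (simp add: sat_BigOr)
  have "sat F V 0 ?\<chi>" if F: "F \<in> FL" and "sat F V 0 \<phi>" for F V
  proof -
    have "finite (worlds F)" "rooted_frame F" "taut (PImp (tr F 0 \<phi>) (\<xi> F))"
      using FL(2)[OF F] interp[OF F] by auto
    then show ?thesis
      using sat_rt_of_sat[OF FL(1) _ _ F enc \<sigma>(1) assms(10)[OF F]] that unfolding sat\<chi> by blast
  qed
  moreover have "sat F V 0 \<psi>" if F: "F \<in> FL" and sat: "sat F V 0 ?\<chi>" for F V
  proof (rule ccontr)
    assume nsat: "\<not> sat F V 0 \<psi>"
    obtain G where G: "G \<in> FL" "sat F V 0 (rt FL \<sigma> \<Gamma> \<Delta> G (\<xi> G))"
      using sat sat\<chi> by blast
    obtain U where U: "peval (\<lambda>(p, w). U w p) (\<xi> G)"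
        "\<And>\<theta>. sig \<theta> \<subseteq> \<sigma> \<Longrightarrow> sat F V 0 \<theta> \<longleftrightarrow> sat G U 0 \<theta>"
      using same_theory_of_sat_rt[OF FL enc \<sigma>(1) F G] by blast
    obtain U' where U': "\<And>w p. w \<in> worlds G \<Longrightarrow> p \<in> \<sigma> \<Longrightarrow> U' w p \<longleftrightarrow> U w p" "\<not> sat G U' 0 \<psi>"
      using refuting_expansion[OF FL minimal craig F nsat G(1) \<sigma>(2) U(2)] by blast
    \<comment> \<open>All variables of \<open>\<xi> G\<close> are pairs in
      \<open>\<sigma> \<times> worlds G\<close>, where \<open>U'\<close> and \<open>U\<close>
      agree.\<close>
    have "peval (\<lambda>(p, w). U' w p) (\<xi> G) \<longleftrightarrow> peval (\<lambda>(p, w). U w p) (\<xi> G)"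
      using U'(1) assms(10)[OF G(1)] by (intro peval_cong) auto
    then have "peval (\<lambda>(p, w). U' w p) (tr G 0 \<psi>)"
      using U(1) interp[OF G(1)] by (auto simp: taut_def)
    moreover have "finite (worlds G)" "acc G \<subseteq> worlds G \<times> worlds G"
      using FL(2)[OF G(1)] by (simp_all add: rooted_frame_def)
    ultimately show False
      using U'(2) by (simp add: peval_tr)
  qed
  moreover have "sig ?\<chi> \<subseteq> \<sigma>"
    using sig_rt[OF enc _ \<sigma>(1) assms(10)] FL by (auto simp: sig_BigOr)
  ultimately show ?thesis
    unfolding craig_interpolant_def assms(3) Log_def using assms(8) by simp
qed

end
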